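(* Let $\rho(n)$ be the $12$-periodic function defined by \[ \rho(n)=\begin{cases}1,& n\equiv1,2,5,10\pmod{12},\\ 2,& n\equiv6,9\pmod{12},\\ -1,& n\equiv4,7,8,11\pmod{12},\\ 0,& n\equiv0,3\pmod{12}.\end{cases} \] For $1\le u\le8$, set \[ \mu_u(n)=\begin{cases}\dfrac{1-(-1)^n}{2},& u=1,7,\\[4pt] 1,& u=2,6,\\[2pt] 1+\dfrac{1+(-1)^n}{2},& u=3,5,\\[4pt] 2,& u=4,\\ 0,& u=8.\end{cases} \] Let $T_s=\binom{s+1}{2}$ for $s\ge0$, and let $\chi(n)=-1$ if $n\equiv0,1\pmod4$ and $\chi(n)=1$ if $n\equiv2,3\pmod4$. Then $b_2''(0)=0$, and for every $n\ge1$ with \[ T_{8m+u-1}<n\le T_{8m+u}\qquad(m\ge0,\ 1\le u\le8), \] we have \[ b_2''(n)=\rho(n)+\mu_u(n)\,\chi(n-1). \]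
   Context: Notation: $(x;q^2)_0=1$ and $(x;q^2)_n=\prod_{j=0}^{n-1}(1-xq^{2j})$. Consider partitions of $n$ for which there are integers $l\ge2$, $1\le k\le l-1$ such that: there are exactly $l-1$ parts equal to $1$; the smallest even part is $2k$; every part greater than $1$ lies in the interval $[2k,2l-1]$; and the odd parts greater than $1$ are distinct. Then $b_2''(n)$ is the signed count of these partitions in which each partition is weighted by $(-1)^{j+1}$, where $j$ is its number of parts greater than $1$. Equivalently, as formal power series in $q$, \[ \sum_{n\ge0}b_2''(n)q^n=\sum_{\substack{l\ge2\\1\le k\le l-1}}\frac{(q^{2k+1};q^2)_{l-k}}{(-q^{2k};q^2)_{l-k}}q^{2k+l-1}. \] *)

theory Defs
  imports "HOL-Library.Multiset"
begin

(* A partition of n is the multiset of its parts, all of them positive. *)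

definition partitions_of :: "nat \<Rightarrow> nat multiset set" where
  "partitions_of n = {M. 0 \<notin># M \<and> sum_mset M = n}"

lemma finite_partitions_of: "finite (partitions_of n)"
proof -
  have "partitions_of n \<subseteq> mset ` {xs. set xs \<subseteq> {..n} \<and> length xs \<le> n}"
  proof
    fix M assume "M \<in> partitions_of n"
    then have pos: "0 \<notin># M" and sum: "sum_mset M = n"
      by (auto simp: partitions_of_def)
    obtain xs where xs: "M = mset xs"
      using ex_mset by metis
    have sl: "sum_list xs = n"
      using sum xs by (simp add: sum_mset_sum_list)
    have "set xs \<subseteq> {..n}"
      using sl member_le_sum_list by fastforce
    moreover have "length ys \<le> sum_list ys" if "0 \<notin> set ys" for ys :: "nat list"
      using that by (induction ys) auto
    then have "length xs \<le> n"
      using pos xs sl by auto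
    ultimately show "M \<in> mset ` {xs. set xs \<subseteq> {..n} \<and> length xs \<le> n}"
      using xs by blast
  qed
  then show ?thesis
    by (rule finite_subset) (simp add: finite_lists_length_le)
qed

definition admissible :: "nat multiset \<Rightarrow> bool" where
  "admissible M \<longleftrightarrow> (\<exists>l k. 2 \<le> l \<and> 1 \<le> k \<and> k \<le> l - 1 \<and>
     count M 1 = l - 1 \<and>
     2 * k \<in># M \<and> (\<forall>p\<in>#M. even p \<longrightarrow> 2 * k \<le> p) \<and>
     (\<forall>p\<in>#M. p > 1 \<longrightarrow> p \<in> {2 * k..2 * l - 1}) \<and>
     (\<forall>p\<in>#M. odd p \<and> p > 1 \<longrightarrow> count M p = 1))"

definition b2'' :: "nat \<Rightarrow> int" where
  "b2'' n = (\<Sum>M \<in> {M \<in> partitions_of n. admissible M}.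
     (-1) ^ (size (filter_mset (\<lambda>p. p > 1) M) + 1))"

definition \<rho> :: "nat \<Rightarrow> int" where
  "\<rho> n =
    (if n mod 12 \<in> {1, 2, 5, 10} then 1
     else if n mod 12 \<in> {6, 9} then 2
     else if n mod 12 \<in> {4, 7, 8, 11} then -1
     else 0)"

(* Both divisions by 2 are exact.  Only 1 \<le> u \<le> 8 is meaningful; the final
   branch is the value at u = 8. *)

definition \<mu> :: "nat \<Rightarrow> nat \<Rightarrow> int" where
  "\<mu> u n =
    (if u \<in> {1, 7} then (1 - (-1) ^ n) div 2
     else if u \<in> {2, 6} then 1
     else if u \<in> {3, 5} then 1 + (1 + (-1) ^ n) div 2
     else if u = 4 then 2
     else 0)"

definition T :: "nat \<Rightarrow> nat" where
  "T s = (s + 1) choose 2"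

definition \<chi> :: "nat \<Rightarrow> int" where
  "\<chi> n = (if n mod 4 \<in> {0, 1} then -1 else 1)"

end

theory Submission
  imports Defs "HOL-Computational_Algebra.Formal_Power_Series"
begin

text \<open>
Write \<open>i = l - 1\<close> for the number of ones, \<open>H i\<close> for the signed generating function of the parts
greater than 1, and $F = \sum_i q^i H_i$ for the generating function of \<open>b2''\<close>.

Splitting off the largest possible odd and even part gives the recurrence
$(1+q^{2i+2}) H_{i+1} = (1-q^{2i+3}) (H_i + q^{2i+2})$ (\<open>H_Suc\<close>). Its solution is elementary
(\<open>H_closed_form\<close>):
\[ (1+q) H_i = q - q^{2i+2} - q (1-q) \frac{(q^3;q^2)_i}{(-q^2;q^2)_i}. \]
So the double series is in fact a single one: $(1+q) F$ consists of two geometric series and a series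
$\sum_i q^i (q^3;q^2)_i / (-q^2;q^2)_i$ of Fine's type.

The Rogers-Fine identity turns the latter into a false theta series (\<open>rogers_fine_truncated\<close>),
\[ (1+q^2)(1-q) \sum_i q^i \frac{(q^3;q^2)_i}{(-q^2;q^2)_i}
   = \sum_j (-1)^j q^{2j^2+j} (1+q^{2j+2}) (1-q^{4j+4}), \]
whose exponents are the triangular numbers $T_s$ and their successors. It equals
$(1+q) \Psi - 2q$ with $\Psi = \sum_s (-1)^{\lfloor s/2 \rfloor} q^{T_s}$, and therefore (\<open>gf_identity\<close>)
\[ (1+q)(1+q^2) F = (1+q^2) \Bigl(\frac{q}{1-q} - \frac{q^2}{1-q^3}\Bigr) + 2q^2 - q (1+q) \Psi. \]

The rational part of $F$ has poles at 12th roots of unity only and its coefficients are \<open>\<rho>\<close>. What is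
left is $-q\Psi/(1+q^2)$: its coefficients change sign in each step of length 2, except that each
triangular number adds a new contribution. Between consecutive triangular numbers they are therefore
$\chi(n-1)$ times a constant for each parity of \<open>n\<close>, and following the jumps through one period of $T_s$ modulo
4, which is 8, gives \<open>\<mu>\<close> (\<open>b2_minus_\<rho>_eq\<close>).

The coefficients are taken in a field so that the denominators $(-q^2;q^2)_i$ have inverses.
\<close>

unbundle fps_syntax

section \<open>Signed generating functions of sets of partitions\<close>

text \<open>The coefficient of $q^n$ is meaningful when no member of \<open>A\<close> contains the part 0, since then only
finitely many members have sum \<open>n\<close>; a set sum over an infinite index set would silently be 0.\<close>
definition signed_gf :: "nat multiset set \<Rightarrow> rat fps" where
  "signed_gf A = Abs_fps (\<lambda>n. \<Sum>R \<in> {R \<in> A. sum_mset R = n}. (-1) ^ (size R + 1))"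

lemma finite_parts_with_sum:
  fixes n :: nat
  assumes "\<forall>R\<in>A. 0 \<notin># R"
  shows "finite {R \<in> A. sum_mset R = n}"
  by (rule finite_subset[OF _ finite_partitions_of[of n]]) (use assms in \<open>auto simp: partitions_of_def\<close>)

lemma signed_gf_Un:
  assumes "\<forall>R\<in>A \<union> B. 0 \<notin># R" "A \<inter> B = {}"
  shows "signed_gf (A \<union> B) = signed_gf A + signed_gf B"
proof (rule fps_ext)
  fix n
  have eq: "{R \<in> A \<union> B. sum_mset R = n} = {R \<in> A. sum_mset R = n} \<union> {R \<in> B. sum_mset R = n}"
    by blast
  show "signed_gf (A \<union> B) $ n = (signed_gf A + signed_gf B) $ n"
    unfolding signed_gf_def fps_add_nth fps_nth_Abs_fps eq
    by (rule sum.union_disjoint)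
      (use assms in \<open>auto intro!: finite_parts_with_sum\<close>)
qed

lemma signed_gf_add_mset: "signed_gf (add_mset p ` A) = - (fps_X ^ p) * signed_gf A"
proof (rule fps_ext)
  fix n
  show "signed_gf (add_mset p ` A) $ n = (- (fps_X ^ p) * signed_gf A) $ n"
  proof (cases "p \<le> n")
    case True
    have "{R \<in> add_mset p ` A. sum_mset R = n} = add_mset p ` {R \<in> A. sum_mset R = n - p}"
      using True by auto
    then have "signed_gf (add_mset p ` A) $ n
        = (\<Sum>R\<in>add_mset p ` {R \<in> A. sum_mset R = n - p}. (-1) ^ (size R + 1))"
      by (simp add: signed_gf_def)
    also have "\<dots> = - (signed_gf A $ (n - p))"
      by (subst sum.reindex) (auto simp: signed_gf_def inj_on_def sum_negf)
    finally show ?thesis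
      using True by (simp add: fps_X_power_mult_nth)
  next
    case False
    then have none: "{R \<in> add_mset p ` A. sum_mset R = n} = {}" by auto
    show ?thesis
      unfolding signed_gf_def fps_nth_Abs_fps none
      using False by (simp add: fps_X_power_mult_nth)
  qed
qed

lemma signed_gf_empty_partition: "signed_gf {{#}} = -1"
proof (rule fps_ext)
  fix n :: nat
  have "{R :: nat multiset. R = {#} \<and> sum_mset R = n} = (if n = 0 then {{#}} else {})" by auto
  then show "signed_gf {{#}} $ n = (- 1) $ n"
    by (simp add: signed_gf_def)
qed

section \<open>The parts greater than one\<close>

text \<open>What remains of an admissible partition with \<open>i = l - 1\<close> ones after the ones are removed. Every part
is at least \<open>2 * k\<close> and \<open>2 * k\<close> occurs, so \<open>2 * k\<close> is automatically the smallest even part.\<close>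
definition big_parts :: "nat \<Rightarrow> nat multiset set" where
  "big_parts i = {R. \<exists>k. 1 \<le> k \<and> k \<le> i \<and> 2 * k \<in># R \<and>
     (\<forall>p\<in>#R. 2 * k \<le> p \<and> p \<le> 2 * i + 1) \<and> (\<forall>p\<in>#R. odd p \<longrightarrow> count R p = 1)}"

lemma big_partsI:
  assumes "1 \<le> k" "k \<le> i" "2 * k \<in># R" "\<And>p. p \<in># R \<Longrightarrow> 2 * k \<le> p"
    "\<And>p. p \<in># R \<Longrightarrow> p \<le> 2 * i + 1" "\<And>p. p \<in># R \<Longrightarrow> odd p \<Longrightarrow> count R p = 1"
  shows "R \<in> big_parts i"
  using assms unfolding big_parts_def by blast

lemma zero_notin_big_parts: "R \<in> big_parts i \<Longrightarrow> 0 \<notin># R"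
  by (fastforce simp: big_parts_def)

lemma big_parts_0: "big_parts 0 = {}"
  by (auto simp: big_parts_def)

text \<open>The largest odd part allowed, \<open>2 * i + 3\<close>, occurs at most once. Removing it keeps the smallest even
part, so the partitions that contain it are the others with that part added.\<close>
lemma big_parts_Suc_split_odd:
  fixes i :: nat
  defines "A' \<equiv> {R \<in> big_parts (Suc i). 2 * i + 3 \<notin># R}"
  shows "big_parts (Suc i) = A' \<union> add_mset (2 * i + 3) ` A'"
proof (intro equalityI subsetI)
  fix R assume R: "R \<in> big_parts (Suc i)"
  show "R \<in> A' \<union> add_mset (2 * i + 3) ` A'"
  proof (cases "2 * i + 3 \<in># R")
    case True
    then obtain S where S: "R = add_mset (2 * i + 3) S" by (metis insert_DiffM)
    from R obtain k where k: "1 \<le> k" "k \<le> Suc i" "2 * k \<in># R"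
      "\<forall>p\<in>#R. 2 * k \<le> p \<and> p \<le> 2 * Suc i + 1" "\<forall>p\<in>#R. odd p \<longrightarrow> count R p = 1"
      unfolding big_parts_def by blast
    have "count R (2 * i + 3) = 1" using k(5) True by auto
    then have nin: "2 * i + 3 \<notin># S" using S by (simp add: not_in_iff)
    have "S \<in> big_parts (Suc i)"
    proof (rule big_partsI[of k])
      have "2 * k \<noteq> 2 * i + 3" by presburger
      then show "2 * k \<in># S" using k(3) S by simp
      fix p assume p: "p \<in># S"
      show "2 * k \<le> p" "p \<le> 2 * Suc i + 1" using k(4) p S by auto
      have "p \<noteq> 2 * i + 3" using p nin by auto
      then show "odd p \<Longrightarrow> count S p = 1" using k(5) p S by auto
    qed (use k in auto)
    then show ?thesis using nin S by (auto simp: A'_def)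
  qed (use R in \<open>simp add: A'_def\<close>)
next
  fix R assume "R \<in> A' \<union> add_mset (2 * i + 3) ` A'"
  then consider "R \<in> A'" | S where "S \<in> A'" "R = add_mset (2 * i + 3) S" by blast
  then show "R \<in> big_parts (Suc i)"
  proof cases
    case 2
    then have nin: "2 * i + 3 \<notin># S" and "S \<in> big_parts (Suc i)" by (auto simp: A'_def)
    then obtain k where k: "1 \<le> k" "k \<le> Suc i" "2 * k \<in># S"
      "\<forall>p\<in>#S. 2 * k \<le> p \<and> p \<le> 2 * Suc i + 1" "\<forall>p\<in>#S. odd p \<longrightarrow> count S p = 1"
      unfolding big_parts_def by blast
    show ?thesis
      by (rule big_partsI[of k]) (use k nin 2 in \<open>auto simp: not_in_iff\<close>)
  qed (simp add: A'_def)
qed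

text \<open>Removing one copy of the largest even part \<open>2 * i + 2\<close> is again admissible, except when this copy was
the only part: that is where the empty partition comes from. If no copy is present, the bounds are
those for \<open>i\<close>.\<close>
lemma big_parts_Suc_split_even:
  fixes i :: nat
  defines "A' \<equiv> {R \<in> big_parts (Suc i). 2 * i + 3 \<notin># R}"
  shows "A' = big_parts i \<union> add_mset (2 * i + 2) ` ({{#}} \<union> A')"
proof (intro equalityI subsetI)
  fix R assume R: "R \<in> A'"
  then obtain k where k: "1 \<le> k" "k \<le> Suc i" "2 * k \<in># R"
      "\<forall>p\<in>#R. 2 * k \<le> p \<and> p \<le> 2 * Suc i + 1" "\<forall>p\<in>#R. odd p \<longrightarrow> count R p = 1"
    and nin: "2 * i + 3 \<notin># R"
    unfolding A'_def big_parts_def by blast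
  show "R \<in> big_parts i \<union> add_mset (2 * i + 2) ` ({{#}} \<union> A')"
  proof (cases "2 * i + 2 \<in># R")
    case False
    have "R \<in> big_parts i"
    proof (rule big_partsI[of k])
      have "k \<noteq> Suc i" using k(3) False by auto
      then show "k \<le> i" using k(2) by simp
      fix p assume p: "p \<in># R"
      have "p \<noteq> 2 * i + 2" "p \<noteq> 2 * i + 3" using p False nin by auto
      then show "p \<le> 2 * i + 1" using k(4) p by fastforce
    qed (use k in auto)
    then show ?thesis by blast
  next
    case True
    then obtain S where S: "R = add_mset (2 * i + 2) S" by (metis insert_DiffM)
    have "S \<in> big_parts (Suc i)" if "S \<noteq> {#}"
    proof (cases "2 * k \<in># S")
      case True
      show ?thesis
        by (rule big_partsI[of k]) (use k S True in \<open>auto split: if_splits\<close>)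
    next
      case False
      \<comment> \<open>The removed copy was the smallest even part, so all parts equal it.\<close>
      then have "k = Suc i" using k(3) S by auto
      have "p = 2 * i + 2" if "p \<in># S" for p
      proof -
        have "p \<in># R" using that S by simp
        then have "2 * i + 2 \<le> p" "p \<le> 2 * i + 3" "p \<noteq> 2 * i + 3"
          using k(4) nin \<open>k = Suc i\<close> by fastforce+
        then show ?thesis by simp
      qed
      then show ?thesis using False \<open>k = Suc i\<close> that by (metis add_2_eq_Suc' mult_Suc_right add.commute multiset_nonemptyE)
    qed
    then show ?thesis using S nin by (auto simp: A'_def)
  qed
next
  fix R assume "R \<in> big_parts i \<union> add_mset (2 * i + 2) ` ({{#}} \<union> A')"
  then consider "R \<in> big_parts i" | "R = {#2 * i + 2#}"
    | S where "S \<in> A'" "R = add_mset (2 * i + 2) S" by blast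
  then show "R \<in> A'"
  proof cases
    case 1
    then obtain k where k: "1 \<le> k" "k \<le> i" "2 * k \<in># R"
      "\<forall>p\<in>#R. 2 * k \<le> p \<and> p \<le> 2 * i + 1" "\<forall>p\<in>#R. odd p \<longrightarrow> count R p = 1"
      unfolding big_parts_def by blast
    have "R \<in> big_parts (Suc i)"
      by (rule big_partsI[of k]) (use k in fastforce)+
    then show ?thesis using k(4) by (fastforce simp: A'_def)
  next
    case 2
    have "R \<in> big_parts (Suc i)"
      by (rule big_partsI[of "Suc i"]) (use 2 in auto)
    then show ?thesis using 2 by (simp add: A'_def)
  next
    case 3
    then have nin: "2 * i + 3 \<notin># S" and "S \<in> big_parts (Suc i)" by (auto simp: A'_def)
    then obtain k where k: "1 \<le> k" "k \<le> Suc i" "2 * k \<in># S"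
      "\<forall>p\<in>#S. 2 * k \<le> p \<and> p \<le> 2 * Suc i + 1" "\<forall>p\<in>#S. odd p \<longrightarrow> count S p = 1"
      unfolding big_parts_def by blast
    have "R \<in> big_parts (Suc i)"
      by (rule big_partsI[of k]) (use k 3 in auto)
    then show ?thesis using nin 3 by (auto simp: A'_def)
  qed
qed

abbreviation H :: "nat \<Rightarrow> rat fps" where
  "H i \<equiv> signed_gf (big_parts i)"

lemma H_0: "H 0 = 0"
  by (rule fps_ext) (simp add: big_parts_0 signed_gf_def)

text \<open>The two splittings in terms of generating functions: the factor $1 - q^{2i+3}$ accounts for the
largest odd part, the factor $1 + q^{2i+2}$ for the geometric series of the largest even part.\<close>
lemma H_Suc:
  "(1 + fps_X ^ (2 * i + 2)) * H (Suc i)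
     = (1 - fps_X ^ (2 * i + 3)) * (H i + fps_X ^ (2 * i + 2))"
proof -
  define A' where "A' = {R \<in> big_parts (Suc i). 2 * i + 3 \<notin># R}"
  have pos: "\<forall>R\<in>A'. 0 \<notin># R" "\<forall>R\<in>big_parts i. 0 \<notin># R"
    using zero_notin_big_parts by (auto simp: A'_def)
  have "H (Suc i) = signed_gf (A' \<union> add_mset (2 * i + 3) ` A')"
    using big_parts_Suc_split_odd A'_def by simp
  also have "\<dots> = (1 - fps_X ^ (2 * i + 3)) * signed_gf A'"
    using pos by (subst signed_gf_Un) (auto simp: signed_gf_add_mset A'_def algebra_simps)
  finally have 1: "H (Suc i) = (1 - fps_X ^ (2 * i + 3)) * signed_gf A'" .
  have "signed_gf A' = signed_gf (big_parts i \<union> add_mset (2 * i + 2) ` ({{#}} \<union> A'))"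
    using big_parts_Suc_split_even A'_def by simp
  also have "\<dots> = H i + signed_gf (add_mset (2 * i + 2) ` ({{#}} \<union> A'))"
    using pos by (subst signed_gf_Un) (fastforce simp: big_parts_def)+
  also have "\<dots> = H i - fps_X ^ (2 * i + 2) * signed_gf ({{#}} \<union> A')"
    by (simp only: signed_gf_add_mset) simp
  also have "signed_gf ({{#}} \<union> A') = signed_gf A' - 1"
    using pos by (subst signed_gf_Un) (auto simp: signed_gf_empty_partition A'_def big_parts_def)
  finally have "(1 + fps_X ^ (2 * i + 2)) * signed_gf A' = H i + fps_X ^ (2 * i + 2)"
    by (simp add: algebra_simps)
  then show ?thesis unfolding 1 by (metis mult.left_commute)
qed

text \<open>The number of ones determines \<open>l\<close>, so only \<open>k\<close> remains existentially quantified.\<close>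
lemma admissible_iff:
  assumes "0 \<notin># M"
  shows "admissible M \<longleftrightarrow> filter_mset (\<lambda>p. p > 1) M \<in> big_parts (count M 1)"
proof
  assume "admissible M"
  then obtain l k where "2 \<le> l" "1 \<le> k" "k \<le> l - 1" "count M 1 = l - 1" "2 * k \<in># M"
    "\<forall>p\<in>#M. p > 1 \<longrightarrow> p \<in> {2 * k..2 * l - 1}"
    "\<forall>p\<in>#M. odd p \<and> p > 1 \<longrightarrow> count M p = 1"
    unfolding admissible_def by blast
  then show "filter_mset (\<lambda>p. p > 1) M \<in> big_parts (count M 1)"
    by (intro big_partsI[of k]) auto
next
  assume "filter_mset (\<lambda>p. p > 1) M \<in> big_parts (count M 1)"
  then obtain k where k: "1 \<le> k" "k \<le> count M 1" "2 * k \<in># M"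
    "\<And>p. p \<in># M \<Longrightarrow> p > 1 \<Longrightarrow> 2 * k \<le> p \<and> p \<le> 2 * count M 1 + 1"
    "\<And>p. p \<in># M \<Longrightarrow> p > 1 \<Longrightarrow> odd p \<Longrightarrow> count M p = 1"
    unfolding big_parts_def by auto
  \<comment> \<open>The clause of admissibility on even parts follows from the lower bound on all parts above 1.\<close>
  have ev: "p > 1" if "p \<in># M" "even p" for p
    using that assms by (cases p; cases "p - 1") auto
  have "1 \<in># M" using k by (metis One_nat_def count_greater_zero_iff le_trans less_eq_Suc_le)
  show "admissible M"
    unfolding admissible_def
    by (rule exI[of _ "count M 1 + 1"], rule exI[of _ k]) (use k ev \<open>1 \<in># M\<close> in auto)
qed

lemma b2''_eq_sum_coeffs: "of_int (b2'' n) = (\<Sum>i\<le>n. H i $ (n - i))"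
proof -
  let ?A = "{M \<in> partitions_of n. admissible M}"
  let ?B = "SIGMA i:{..n}. {R \<in> big_parts i. sum_mset R = n - i}"
  let ?big = "filter_mset (\<lambda>p::nat. p > 1)"
  have split: "replicate_mset (count M 1) 1 + ?big M = M" if "0 \<notin># M" for M :: "nat multiset"
  proof (rule multiset_eqI)
    fix p
    show "count (replicate_mset (count M 1) 1 + ?big M) p = count M p"
      using that by (cases "p = 0"; cases "p = 1") (auto simp: not_in_iff)
  qed
  have big: "?big (replicate_mset i 1 + R) = R" "count (replicate_mset i 1 + R) 1 = i"
    if "R \<in> big_parts i" for i R
  proof -
    from that have gt: "\<forall>p\<in>#R. p > 1" unfolding big_parts_def by fastforce
    then have "1 \<notin># R" by blast
    then show "count (replicate_mset i 1 + R) 1 = i" by (simp add: not_in_iff)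
    have "?big (replicate_mset i 1) = {#}" by (simp add: filter_mset_eq_conv)
    moreover have "?big R = R" using gt by (simp add: filter_mset_eq_conv)
    ultimately show "?big (replicate_mset i 1 + R) = R" by simp
  qed
  have "of_int (b2'' n) = (\<Sum>M\<in>?A. (-1 :: rat) ^ (size (?big M) + 1))"
    by (simp add: b2''_def)
  also have "\<dots> = (\<Sum>(i, R)\<in>?B. (-1) ^ (size R + 1))"
  proof (rule sum.reindex_bij_witness[of _ "\<lambda>(i, R). replicate_mset i 1 + R" "\<lambda>M. (count M 1, ?big M)"])
    fix M assume "M \<in> ?A"
    then have M: "0 \<notin># M" "sum_mset M = n" "admissible M" by (auto simp: partitions_of_def)
    show "(case (count M 1, ?big M) of (i, R) \<Rightarrow> replicate_mset i 1 + R) = M"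
      using split M by simp
    have "sum_mset (replicate_mset (count M 1) 1 + ?big M) = n"
      using split M by simp
    then have "count M 1 + sum_mset (?big M) = n" by simp
    then show "(count M 1, ?big M) \<in> ?B"
      using M admissible_iff by auto
    show "(case (count M 1, ?big M) of (i, R) \<Rightarrow> (-1) ^ (size R + 1)) = (-1 :: rat) ^ (size (?big M) + 1)"
      by simp
  next
    fix z assume "z \<in> ?B"
    then obtain i R where z: "z = (i, R)" "i \<le> n" "R \<in> big_parts i" "sum_mset R = n - i" by auto
    show "(count (case z of (i, R) \<Rightarrow> replicate_mset i 1 + R) 1,
           ?big (case z of (i, R) \<Rightarrow> replicate_mset i 1 + R)) = z"
      using big z by simp
    have "0 \<notin># replicate_mset i 1 + R" using zero_notin_big_parts z by auto
    then show "(case z of (i, R) \<Rightarrow> replicate_mset i 1 + R) \<in> ?A"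
      using big z admissible_iff by (auto simp: partitions_of_def)
  qed
  also have "\<dots> = (\<Sum>i\<le>n. H i $ (n - i))"
    by (subst sum.Sigma[symmetric]) (auto simp: signed_gf_def intro!: finite_parts_with_sum zero_notin_big_parts)
  finally show ?thesis .
qed

section \<open>Solving the recurrence\<close>

text \<open>Infinite sums of power series are handled by truncation: two series agree up to $q^{M-1}$ iff
$q^M$ divides their difference.\<close>
lemma fps_X_power_dvd_iff:
  "fps_X ^ M dvd (f :: rat fps) \<longleftrightarrow> (\<forall>n<M. f $ n = 0)"
proof
  assume "\<forall>n<M. f $ n = 0"
  then have "fps_cutoff M f = 0" by (simp add: fps_eq_iff)
  then have "fps_X ^ M * fps_shift M f = f"
    using fps_shift_cutoff'[of M f] by simp
  then show "fps_X ^ M dvd f" by (metis dvd_triv_left)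
qed (auto simp: fps_X_power_mult_nth)

text \<open>This is $(q^{2j+3};q^2)_n / (-q^{2j+2};q^2)_n$.\<close>
definition qpoch_ratio :: "nat \<Rightarrow> nat \<Rightarrow> rat fps" where
  "qpoch_ratio j n = (\<Prod>i<n. (1 - fps_X ^ (2 * j + 2 * i + 3)) * inverse (1 + fps_X ^ (2 * j + 2 * i + 2)))"

lemma one_plus_X_power_inverse:
  assumes "k > 0"
  shows "(1 + fps_X ^ k) * inverse (1 + fps_X ^ k :: rat fps) = 1"
  using assms by (intro inverse_mult_eq_1') simp

lemma qpoch_ratio_Suc:
  "(1 + fps_X ^ (2 * j + 2 * n + 2)) * qpoch_ratio j (Suc n) = (1 - fps_X ^ (2 * j + 2 * n + 3)) * qpoch_ratio j n"
proof -
  have "(1 + fps_X ^ (2 * j + 2 * n + 2)) * qpoch_ratio j (Suc n)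
    = (1 - fps_X ^ (2 * j + 2 * n + 3)) * qpoch_ratio j n
      * ((1 + fps_X ^ (2 * j + 2 * n + 2)) * inverse (1 + fps_X ^ (2 * j + 2 * n + 2)))"
    unfolding qpoch_ratio_def prod.lessThan_Suc by (simp only: ac_simps)
  then show ?thesis by (subst (asm) one_plus_X_power_inverse) simp_all
qed

lemma qpoch_ratio_Suc_shift:
  "(1 + fps_X ^ (2 * j + 2)) * qpoch_ratio j (Suc n) = (1 - fps_X ^ (2 * j + 3)) * qpoch_ratio (Suc j) n"
proof -
  have "qpoch_ratio j (Suc n) = (1 - fps_X ^ (2 * j + 3)) * inverse (1 + fps_X ^ (2 * j + 2)) * qpoch_ratio (Suc j) n"
    unfolding qpoch_ratio_def prod.lessThan_Suc_shift by (simp add: algebra_simps)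
  then have "(1 + fps_X ^ (2 * j + 2)) * qpoch_ratio j (Suc n)
    = (1 - fps_X ^ (2 * j + 3)) * qpoch_ratio (Suc j) n
      * ((1 + fps_X ^ (2 * j + 2)) * inverse (1 + fps_X ^ (2 * j + 2)))"
    by (simp only: ac_simps)
  then show ?thesis by (subst (asm) one_plus_X_power_inverse) simp_all
qed

lemma one_plus_X_power_nonzero: "k > 0 \<Longrightarrow> 1 + fps_X ^ k \<noteq> (0 :: rat fps)"
  by (metis one_plus_X_power_inverse mult_zero_left zero_neq_one)

text \<open>The sum over \<open>k\<close> that \<open>H i\<close> stands for is Gosper-summable. In the form of a recurrence: the right-hand
side without its last term satisfies the inhomogeneous recurrence \<open>H_Suc\<close> multiplied by $1+q$, and
the last term solves the homogeneous one with the initial value that makes both sides vanish at 0.\<close>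
lemma H_closed_form:
  "(1 + fps_X) * H i = fps_X - fps_X ^ (2 * i + 2) - fps_X * (1 - fps_X) * qpoch_ratio 0 i"
proof (induction i)
  case 0
  show ?case by (simp add: H_0 qpoch_ratio_def algebra_simps power2_eq_square)
next
  case (Suc i)
  define Y :: "rat fps" where "Y = fps_X ^ (2 * i + 2)"
  define X :: "rat fps" where "X = fps_X"
  have h: "(1 + Y) * H (Suc i) = (1 - X * Y) * (H i + Y)"
    using H_Suc[of i] by (simp add: Y_def X_def numeral_3_eq_3)
  have p: "(1 + Y) * qpoch_ratio 0 (Suc i) = (1 - X * Y) * qpoch_ratio 0 i"
    using qpoch_ratio_Suc[of 0 i] by (simp add: Y_def X_def numeral_3_eq_3)
  have ih: "(1 + X) * H i = X - Y - X * (1 - X) * qpoch_ratio 0 i"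
    using Suc by (simp add: Y_def X_def)
  have "(1 + Y) * ((1 + X) * H (Suc i)) = (1 + Y) * (X - X ^ 2 * Y - X * (1 - X) * qpoch_ratio 0 (Suc i))"
    using h p ih by algebra
  moreover have "1 + Y \<noteq> 0" unfolding Y_def by (rule one_plus_X_power_nonzero) simp
  ultimately have "(1 + X) * H (Suc i) = X - X ^ 2 * Y - X * (1 - X) * qpoch_ratio 0 (Suc i)"
    by simp
  moreover have "X ^ 2 * Y = fps_X ^ (2 * Suc i + 2)"
    by (simp add: Y_def X_def power2_eq_square)
  ultimately show ?case by (simp only: X_def)
qed

section \<open>A truncated Rogers-Fine identity\<close>

text \<open>Up to the factor $1+q^{2j+2}$, this is $(1-t)$ times a truncation of Fine's basic hypergeometric
series in base $q^2$ at $t = q^{2j+1}$; the extra factors clear the denominators in the recurrence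
below.\<close>
definition fine_sum :: "nat \<Rightarrow> nat \<Rightarrow> rat fps" where
  "fine_sum M j = (1 + fps_X ^ (2 * j + 2)) * (1 - fps_X ^ (2 * j + 1))
     * (\<Sum>n<M. fps_X ^ (n * (2 * j + 1)) * qpoch_ratio j n)"

text \<open>The telescoping identity behind one step of the Rogers-Fine identity, with $y = q^{2j}$, $x = q^{2n}$,
$t = q^{n(2j+1)}$, and \<open>p\<close>, \<open>p'\<close> two consecutive terms of \<open>qpoch_ratio j\<close>. The two terms
on the right are the values at \<open>n\<close> and \<open>n + 1\<close> of the sequence whose differences are summed.\<close>
lemma rogers_fine_certificate:
  fixes X y x t p p' :: "'a :: idom"
  assumes "(1 + y * x * X ^ 2) * p' = (1 - y * x * X ^ 3) * p"
  shows "(1 - y * X) * (t * p) + y * y * X ^ 3 * (1 + y * X ^ 4) * (t * x * p')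
     = t * p * (1 - y * y * x * X ^ 4) - t * y * X * p' * (1 - y * y * x * X ^ 6)"
  using assms by algebra

text \<open>Shifting \<open>j\<close> by one turns \<open>qpoch_ratio j (Suc n)\<close> into \<open>qpoch_ratio (Suc j) n\<close>, so the two sums combine
termwise into a telescoping one. The last term on the right is its upper boundary value; it is
divisible by $q^M$ and disappears in the limit.\<close>
lemma fine_sum_recurrence:
  "fine_sum M j + fps_X ^ (4 * j + 3) * fine_sum M (Suc j)
     = (1 + fps_X ^ (2 * j + 2)) * ((1 - fps_X ^ (4 * j + 4))
         - fps_X ^ (M * (2 * j + 1)) * qpoch_ratio j M * (1 - fps_X ^ (4 * j + 4 + 2 * M)))"
proof -
  define U where "U n = fps_X ^ (n * (2 * j + 1)) * qpoch_ratio j n * (1 - fps_X ^ (4 * j + 4 + 2 * n))" for n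
  have certificate: "(1 - fps_X ^ (2 * j + 1)) * (fps_X ^ (n * (2 * j + 1)) * qpoch_ratio j n)
     + fps_X ^ (4 * j + 3) * (1 + fps_X ^ (2 * j + 4)) * (fps_X ^ (n * (2 * j + 3)) * qpoch_ratio j (Suc n))
     = U n - U (Suc n)" for n
  proof -
    define X :: "rat fps" where "X = fps_X"
    define y where "y = X ^ (2 * j)"
    define x where "x = X ^ (2 * n)"
    define t where "t = X ^ (n * (2 * j + 1))"
    have "X ^ (2 * j + 1) = y * X" "X ^ (2 * j + 4) = y * X ^ 4"
      by (simp_all only: y_def power_add power_one_right)
    moreover have "X ^ (4 * j + 3) = y * y * X ^ 3"
      by (simp only: y_def power_add[symmetric]) simp
    moreover have "X ^ (4 * j + 4 + 2 * n) = y * y * x * X ^ 4"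
      by (simp only: x_def y_def power_add[symmetric]) (simp add: algebra_simps)
    moreover have "X ^ (4 * j + 4 + 2 * Suc n) = y * y * x * X ^ 6"
      by (simp only: x_def y_def power_add[symmetric]) (simp add: algebra_simps)
    moreover have "X ^ (n * (2 * j + 3)) = t * x"
      by (simp only: x_def t_def power_add[symmetric]) (simp add: algebra_simps)
    moreover have "X ^ (Suc n * (2 * j + 1)) = t * y * X"
      by (simp add: t_def y_def power_add mult.commute)
    moreover have "(1 + y * x * X ^ 2) * qpoch_ratio j (Suc n) = (1 - y * x * X ^ 3) * qpoch_ratio j n"
      using qpoch_ratio_Suc[of j n] unfolding X_def[symmetric] by (simp only: power_add y_def x_def)
    from rogers_fine_certificate[OF this, of t]
    have "(1 - y * X) * (t * qpoch_ratio j n) + y * y * X ^ 3 * (1 + y * X ^ 4) * (t * x * qpoch_ratio j (Suc n))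
      = t * qpoch_ratio j n * (1 - y * y * x * X ^ 4) - t * y * X * qpoch_ratio j (Suc n) * (1 - y * y * x * X ^ 6)" .
    ultimately show ?thesis
      unfolding U_def X_def[symmetric] t_def[symmetric] by (simp only:)
  qed
  have "fine_sum M (Suc j) = (1 + fps_X ^ (2 * j + 4)) * (\<Sum>n<M. fps_X ^ (n * (2 * j + 3)) * ((1 - fps_X ^ (2 * j + 3)) * qpoch_ratio (Suc j) n))"
    unfolding fine_sum_def sum_distrib_left by (rule sum.cong) (simp_all add: eval_nat_numeral algebra_simps)
  also have "\<dots> = (1 + fps_X ^ (2 * j + 2)) * (1 + fps_X ^ (2 * j + 4)) * (\<Sum>n<M. fps_X ^ (n * (2 * j + 3)) * qpoch_ratio j (Suc n))"
    unfolding qpoch_ratio_Suc_shift[symmetric] sum_distrib_left by (rule sum.cong) (simp_all only: ac_simps)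
  finally have fine_sum_Suc: "fine_sum M (Suc j) = (1 + fps_X ^ (2 * j + 2)) * (1 + fps_X ^ (2 * j + 4))
    * (\<Sum>n<M. fps_X ^ (n * (2 * j + 3)) * qpoch_ratio j (Suc n))" .
  have factor: "a * b * s + c * (a * d * t) = a * (b * s + c * d * t)" for a b c d s t :: "rat fps"
    by (simp add: algebra_simps)
  have "fine_sum M j + fps_X ^ (4 * j + 3) * fine_sum M (Suc j)
     = (1 + fps_X ^ (2 * j + 2)) * ((1 - fps_X ^ (2 * j + 1)) * (\<Sum>n<M. fps_X ^ (n * (2 * j + 1)) * qpoch_ratio j n)
       + fps_X ^ (4 * j + 3) * (1 + fps_X ^ (2 * j + 4)) * (\<Sum>n<M. fps_X ^ (n * (2 * j + 3)) * qpoch_ratio j (Suc n)))"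
    unfolding fine_sum_def[of M j] fine_sum_Suc by (rule factor)
  also have "\<dots> = (1 + fps_X ^ (2 * j + 2)) * (\<Sum>n<M. U n - U (Suc n))"
    unfolding sum_distrib_left[of "1 - fps_X ^ (2 * j + 1)"]
      sum_distrib_left[of "fps_X ^ (4 * j + 3) * (1 + fps_X ^ (2 * j + 4))"] sum.distrib[symmetric] certificate ..
  also have "(\<Sum>n<M. U n - U (Suc n)) = U 0 - U M"
    by (rule sum_lessThan_telescope')
  finally show ?thesis by (simp add: U_def qpoch_ratio_def)
qed

text \<open>The factor $(-1)^j q^{2j^2+j}$ is the product of the factors $-q^{4i+3}$, \<open>i < j\<close>, that the recurrence
for \<open>fine_sum\<close> contributes in its first \<open>j\<close> steps.\<close>
definition theta_term :: "nat \<Rightarrow> rat fps" where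
  "theta_term j = (-1) ^ j * fps_X ^ (2 * j ^ 2 + j) * (1 + fps_X ^ (2 * j + 2)) * (1 - fps_X ^ (4 * j + 4))"

lemma fine_sum_iterate:
  "fps_X ^ M dvd fine_sum M 0 - (\<Sum>j<J. theta_term j) - (-1) ^ J * fps_X ^ (2 * J ^ 2 + J) * fine_sum M J"
proof (induction J)
  case (Suc J)
  define C where "C = (-1) ^ J * fps_X ^ (2 * J ^ 2 + J) * (1 + fps_X ^ (2 * J + 2)) * qpoch_ratio J M * (1 - fps_X ^ (4 * J + 4 + 2 * M))"
  have sq: "2 * (Suc J) ^ 2 + Suc J = (2 * J ^ 2 + J) + (4 * J + 3)"
    by (simp add: power2_eq_square)
  have "fine_sum M 0 - (\<Sum>j<Suc J. theta_term j) - (-1) ^ Suc J * fps_X ^ (2 * (Suc J) ^ 2 + Suc J) * fine_sum M (Suc J)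
    = (fine_sum M 0 - (\<Sum>j<J. theta_term j) - (-1) ^ J * fps_X ^ (2 * J ^ 2 + J) * fine_sum M J)
      - fps_X ^ (M * (2 * J + 1)) * C"
  proof -
    define e where "e = fine_sum M J"
    define e' where "e' = fine_sum M (Suc J)"
    define a b c :: "rat fps"
      where "a = fps_X ^ (4 * J + 3)" and "b = 1 + fps_X ^ (2 * J + 2)" and "c = 1 - fps_X ^ (4 * J + 4)"
    define d :: "rat fps" where "d = qpoch_ratio J M * (1 - fps_X ^ (4 * J + 4 + 2 * M))"
    define g :: "rat fps" where "g = (-1) ^ J * fps_X ^ (2 * J ^ 2 + J)"
    define t :: "rat fps" where "t = fps_X ^ (M * (2 * J + 1))"
    define S where "S = fine_sum M 0 - (\<Sum>j<J. theta_term j)"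
    have "e + a * e' = b * (c - t * d)"
      using fine_sum_recurrence[of M J] unfolding e_def e'_def a_def b_def c_def d_def t_def by (simp only: mult.assoc)
    then have "S - g * b * c + g * a * e' = S - g * e - t * (g * b * d)" by algebra
    moreover have "theta_term J = g * b * c" by (simp add: theta_term_def g_def b_def c_def)
    moreover have "C = g * b * d" by (simp add: C_def g_def b_def d_def ac_simps)
    moreover have "(-1) ^ Suc J * fps_X ^ (2 * (Suc J) ^ 2 + Suc J) * fine_sum M (Suc J) = - (g * a * e')"
      unfolding sq power_add[of fps_X "2 * J ^ 2 + J" "4 * J + 3"] g_def a_def e'_def by simp
    ultimately have "S - theta_term J - (-1) ^ Suc J * fps_X ^ (2 * (Suc J) ^ 2 + Suc J) * fine_sum M (Suc J) = S - g * e - t * C"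
      by (simp only: diff_minus_eq_add)
    then show ?thesis
      unfolding S_def e_def g_def t_def by (simp only: sum.lessThan_Suc diff_diff_eq)
  qed
  moreover have "fps_X ^ M dvd (fps_X ^ (M * (2 * J + 1)) * C :: rat fps)"
    by (intro dvd_mult2 le_imp_power_dvd) simp
  ultimately show ?case using Suc dvd_diff by metis
qed simp

text \<open>After \<open>M\<close> steps of the recurrence the remaining term carries the factor $q^{2M^2+M}$.\<close>
lemma rogers_fine_truncated:
  "fps_X ^ M dvd (1 + fps_X ^ 2) * (1 - fps_X) * (\<Sum>n<M. fps_X ^ n * qpoch_ratio 0 n) - (\<Sum>j<M. theta_term j)"
proof -
  have "fps_X ^ M dvd (-1) ^ M * fps_X ^ (2 * M ^ 2 + M) * fine_sum M M"
    by (intro dvd_mult2[OF dvd_mult] le_imp_power_dvd) simp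
  from dvd_add[OF fine_sum_iterate[of M M] this] show ?thesis
    by (simp add: fine_sum_def numeral_2_eq_2)
qed

section \<open>Triangular numbers and the partial theta series\<close>

definition theta_sign :: "nat \<Rightarrow> rat" where
  "theta_sign s = (-1) ^ (s div 2)"

lemma T_Suc: "T (Suc s) = T s + Suc s"
  by (simp add: T_def numeral_2_eq_2)

lemma T_0: "T 0 = 0"
  by (simp add: T_def)

lemma le_T: "s \<le> T s"
  by (induction s) (simp_all add: T_Suc)

lemma strict_mono_T: "strict_mono T"
  by (simp add: strict_mono_Suc_iff T_Suc)

lemma T_even: "T (2 * j) = 2 * j ^ 2 + j"
  by (induction j) (simp_all add: T_0 T_Suc power2_eq_square)

text \<open>Multiplied out, the \<open>j\<close>-th theta term has the exponents \<open>T (2 * j)\<close>, \<open>T (2 * j + 1) + 1\<close>,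
\<open>T (2 * j + 2) + 1\<close> and \<open>T (2 * j + 3)\<close>. Together these are almost all \<open>T s\<close> and \<open>T s + 1\<close>: the
exponents \<open>T 0 + 1\<close> and \<open>T 1\<close> are missing at the lower end, which is the correction $-2q$, and the
last summand corrects the upper end.\<close>
lemma sum_theta_term:
  "(\<Sum>j<J. theta_term j) = (1 + fps_X) * (\<Sum>s<2 * J. fps_const (theta_sign s) * fps_X ^ T s) - 2 * fps_X
     + (-1) ^ J * (fps_X ^ (T (2 * J) + 1) + fps_X ^ T (2 * J + 1))"
proof (induction J)
  case 0
  show ?case by (simp add: T_0 T_Suc)
next
  case (Suc J)
  define X :: "rat fps" where "X = fps_X"
  define g where "g = (-1) ^ J * X ^ T (2 * J)"
  define y where "y = X ^ (2 * J)"
  have TT: "T (2 * J + 1) = T (2 * J) + 2 * J + 1" "T (2 * Suc J) = T (2 * J) + 2 * J + 2 * J + 3"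
    "T (2 * Suc J + 1) = T (2 * J) + 2 * J + 2 * J + 2 * J + 6"
    by (simp_all add: T_Suc)
  have c: "fps_const (theta_sign (2 * J)) = (-1) ^ J" "fps_const (theta_sign (Suc (2 * J))) = (-1) ^ J"
    by (simp_all add: theta_sign_def fps_const_neg[symmetric] fps_const_power[symmetric] del: fps_const_power fps_const_neg)
  have th: "theta_term J = g * (1 + y * X ^ 2) * (1 - y * y * X ^ 4)"
    unfolding theta_term_def g_def y_def T_even[symmetric] X_def[symmetric] by (simp add: power_add[symmetric] mult_2[symmetric])
  have sum: "(\<Sum>s<2 * Suc J. fps_const (theta_sign s) * fps_X ^ T s)
      = (\<Sum>s<2 * J. fps_const (theta_sign s) * fps_X ^ T s) + g + g * y * X"
  proof -
    have two: "2 * Suc J = Suc (Suc (2 * J))" by simp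
    show ?thesis
      unfolding two sum.lessThan_Suc T_Suc c by (simp add: g_def y_def X_def power_add ac_simps)
  qed
  have tail: "(-1) ^ J * (fps_X ^ (T (2 * J) + 1) + fps_X ^ T (2 * J + 1)) = g * X + g * y * X"
    unfolding TT X_def[symmetric] power_add g_def y_def by (simp add: algebra_simps)
  have tail': "(-1) ^ Suc J * (fps_X ^ (T (2 * Suc J) + 1) + fps_X ^ T (2 * Suc J + 1))
      = - (g * y * y * X ^ 4 + g * y * y * y * X ^ 6)"
    unfolding TT X_def[symmetric] power_add g_def y_def by (simp add: algebra_simps eval_nat_numeral)
  show ?case
    unfolding sum.lessThan_Suc Suc.IH tail th tail' unfolding sum unfolding X_def[symmetric] by (simp add: algebra_simps eval_nat_numeral)
qed

definition partial_theta :: "rat fps" where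
  "partial_theta = Abs_fps (\<lambda>n. \<Sum>s\<le>n. if n = T s then theta_sign s else 0)"

lemma partial_theta_nth_T: "partial_theta $ T s = theta_sign s"
proof -
  have "partial_theta $ T s = (\<Sum>s'\<le>T s. if s' = s then theta_sign s else 0)"
    unfolding partial_theta_def fps_nth_Abs_fps
    by (rule sum.cong) (auto dest: strict_mono_eq[OF strict_mono_T, THEN iffD1])
  then show ?thesis using le_T[of s] by simp
qed

lemma partial_theta_nth_not_T: "n \<notin> range T \<Longrightarrow> partial_theta $ n = 0"
  by (auto simp: partial_theta_def intro!: sum.neutral)

lemma partial_theta_truncated:
  "fps_X ^ M dvd partial_theta - (\<Sum>s<2 * M. fps_const (theta_sign s) * fps_X ^ T s)"
  unfolding fps_X_power_dvd_iff
proof (intro allI impI)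
  fix n assume "n < M"
  then have "(\<Sum>s\<le>n. if n = T s then theta_sign s else 0) = (\<Sum>s<2 * M. if n = T s then theta_sign s else 0)"
    by (intro sum.mono_neutral_left) (use le_T in auto)
  moreover have "(\<Sum>s<2 * M. fps_const (theta_sign s) * fps_X ^ T s) $ n = (\<Sum>s<2 * M. if n = T s then theta_sign s else 0)"
    unfolding fps_sum_nth by (rule sum.cong) auto
  ultimately show "(partial_theta - (\<Sum>s<2 * M. fps_const (theta_sign s) * fps_X ^ T s)) $ n = 0"
    by (simp add: partial_theta_def)
qed

section \<open>The generating function of \<open>b2''\<close>\<close>

definition b2_gf :: "rat fps" where
  "b2_gf = Abs_fps (\<lambda>n. of_int (b2'' n))"

lemma b2_gf_truncated: "fps_X ^ M dvd b2_gf - (\<Sum>i<M. fps_X ^ i * H i)"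
  unfolding fps_X_power_dvd_iff
proof (intro allI impI)
  fix n assume "n < M"
  then have "(\<Sum>i<M. fps_X ^ i * H i) $ n = (\<Sum>i\<le>n. H i $ (n - i))"
    unfolding fps_sum_nth fps_X_power_mult_nth
    by (intro sum.mono_neutral_cong_right) auto
  then show "(b2_gf - (\<Sum>i<M. fps_X ^ i * H i)) $ n = 0"
    by (simp add: b2_gf_def b2''_eq_sum_coeffs)
qed

text \<open>The series $q/(1-q) - q^2/(1-q^3)$.\<close>
definition geometric_sums :: "rat fps" where
  "geometric_sums = Abs_fps (\<lambda>n. (if n = 0 then 0 else 1) - (if n mod 3 = 2 then 1 else 0))"

lemma geometric_sums_truncated: "fps_X ^ M dvd geometric_sums - (\<Sum>i<M. fps_X ^ i * (fps_X - fps_X ^ (2 * i + 2)))"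
  unfolding fps_X_power_dvd_iff
proof (intro allI impI)
  fix n assume n: "n < M"
  have "(\<Sum>i<M. fps_X ^ i * (fps_X - fps_X ^ (2 * i + 2)) :: rat fps) $ n
    = (\<Sum>i<M. (if n = i + 1 then 1 else 0) - (if n = 3 * i + 2 then 1 else 0))"
    unfolding fps_sum_nth
  proof (rule sum.cong)
    fix i :: nat
    have e: "3 * i + 2 = i + (2 * i + 2)" by simp
    have "fps_X ^ i * (fps_X - fps_X ^ (2 * i + 2)) = fps_X ^ (i + 1) - (fps_X ^ (3 * i + 2) :: rat fps)"
      by (simp only: e right_diff_distrib power_add power_one_right)
    then show "(fps_X ^ i * (fps_X - fps_X ^ (2 * i + 2)) :: rat fps) $ n
      = (if n = i + 1 then 1 else 0) - (if n = 3 * i + 2 then 1 else 0)" 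
      by (simp only: fps_sub_nth fps_X_power_nth)
  qed simp
  also have "\<dots> = (\<Sum>i<M. if i = n - 1 then (if n = 0 then 0 else 1) else 0)
      - (\<Sum>i<M. if i = n div 3 then (if n mod 3 = 2 then 1 else 0) else 0)"
    unfolding sum_subtractf[symmetric]
  proof (rule sum.cong)
    fix i
    have "n = i + 1 \<longleftrightarrow> i = n - 1 \<and> n \<noteq> 0" by auto
    moreover have "n = 3 * i + 2 \<longleftrightarrow> i = n div 3 \<and> n mod 3 = 2"
    proof
      assume "n = 3 * i + 2"
      then have n: "n = 2 + 3 * i" by simp
      show "i = n div 3 \<and> n mod 3 = 2"
        unfolding n div_mult_self2[of 3 2 i, simplified] mod_mult_self2 by simp
    next
      assume "i = n div 3 \<and> n mod 3 = 2"
      then show "n = 3 * i + 2" using mult_div_mod_eq[of 3 n] by simp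
    qed
    ultimately show "(if n = i + 1 then 1 else 0) - (if n = 3 * i + 2 then 1 else (0 :: rat))
      = (if i = n - 1 then (if n = 0 then 0 else 1) else 0)
        - (if i = n div 3 then (if n mod 3 = 2 then 1 else 0) else 0)"
      by simp
  qed simp
  also have "\<dots> = geometric_sums $ n"
  proof -
    have "n div 3 < M" "n - 1 < M" using n by auto
    then show ?thesis by (simp add: geometric_sums_def)
  qed
  finally show "(geometric_sums - (\<Sum>i<M. fps_X ^ i * (fps_X - fps_X ^ (2 * i + 2)))) $ n = 0"
    by simp
qed

text \<open>Summing \<open>H_closed_form\<close> over \<open>i\<close> with weight $q^i$ gives two geometric series and the sum evaluated by
\<open>rogers_fine_truncated\<close>. Multiplication by $1+q$ and $1+q^2$ keeps everything free of denominators.\<close>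
lemma gf_identity:
  "(1 + fps_X) * (1 + fps_X ^ 2) * b2_gf
     = (1 + fps_X ^ 2) * geometric_sums - fps_X * (1 + fps_X) * partial_theta + 2 * fps_X ^ 2"
  (is "?L = ?R")
proof -
  define X :: "rat fps" where "X = fps_X"
  have "X ^ M dvd ?L - ?R" for M
  proof -
    define h where "h = (\<Sum>i<M. X ^ i * H i)"
    define a where "a = (\<Sum>i<M. X ^ i * (X - X ^ (2 * i + 2)))"
    define p where "p = (\<Sum>i<M. X ^ i * qpoch_ratio 0 i)"
    define th where "th = (\<Sum>j<M. theta_term j)"
    define \<psi> where "\<psi> = (\<Sum>s<2 * M. fps_const (theta_sign s) * X ^ T s)"
    define v where "v = (-1) ^ M * (X ^ (T (2 * M) + 1) + X ^ T (2 * M + 1))"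
    have "(1 + X) * h = a - X * (1 - X) * p"
    proof -
      have "(1 + X) * h = (\<Sum>i<M. X ^ i * ((1 + X) * H i))"
        unfolding h_def sum_distrib_left by (rule sum.cong) (simp_all only: ac_simps)
      also have "\<dots> = (\<Sum>i<M. X ^ i * (X - X ^ (2 * i + 2)) - X * (1 - X) * (X ^ i * qpoch_ratio 0 i))"
        unfolding X_def H_closed_form by (rule sum.cong) (simp_all add: algebra_simps)
      finally show ?thesis
        unfolding sum_subtractf sum_distrib_left[symmetric] a_def p_def .
    qed
    moreover have "th = (1 + X) * \<psi> - 2 * X + v"
      unfolding th_def \<psi>_def v_def X_def by (rule sum_theta_term)
    \<comment> \<open>The difference is a combination of quantities that are each divisible by the truncation power.\<close>
    ultimately have eq: "?L - ?R = (1 + X) * (1 + X ^ 2) * (b2_gf - h) - (1 + X ^ 2) * (geometric_sums - a)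
      + X * (1 + X) * (partial_theta - \<psi>) - X * ((1 + X ^ 2) * (1 - X) * p - th) - X * v"
      unfolding X_def[symmetric] by algebra
    have "M \<le> T (2 * M)" "M \<le> T (2 * M + 1)"
      using le_T[of "2 * M"] le_T[of "2 * M + 1"] by simp_all
    then have "X ^ M dvd v"
      unfolding v_def by (intro dvd_mult dvd_add le_imp_power_dvd) auto
    moreover have "X ^ M dvd b2_gf - h" "X ^ M dvd geometric_sums - a" "X ^ M dvd partial_theta - \<psi>"
      "X ^ M dvd (1 + X ^ 2) * (1 - X) * p - th"
      unfolding h_def a_def \<psi>_def p_def th_def X_def
      by (rule b2_gf_truncated geometric_sums_truncated partial_theta_truncated rogers_fine_truncated)+
    ultimately show ?thesis
      unfolding eq by (blast intro: dvd_add dvd_diff dvd_mult)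
  qed
  then have "(?L - ?R) $ n = 0" for n
    unfolding X_def fps_X_power_dvd_iff by blast
  then have "?L - ?R = 0" by (simp add: fps_eq_iff)
  then show ?thesis by simp
qed

section \<open>Coefficients\<close>

lemma less_12_cases:
  "r < 12 \<Longrightarrow> r \<in> {0, 1, 2, 3, 4, 5, 6, 7, 8, 9, 10, 11 :: nat}"
  by (simp add: numeral_eq_Suc less_Suc_eq)

text \<open>This is the coefficient identity behind \<open>\<rho>_gf\<close>, away from the initial terms; both sides depend on \<open>k\<close> modulo
12 only.\<close>
lemma \<rho>_recurrence:
  "of_int (\<rho> (k + 3) + \<rho> (k + 2) + \<rho> (k + 1) + \<rho> k) = geometric_sums $ (k + 3) + geometric_sums $ (k + 1)"
proof -
  define t where "t = k div 12"
  define r where "r = k mod 12"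
  have k: "k = r + 12 * t" by (simp add: t_def r_def)
  have \<rho>_mod: "\<rho> (r + 12 * t + i) = \<rho> (r + i)" for i
    by (simp add: \<rho>_def mod_add_left_eq[symmetric, of "r + 12 * t"] mod_add_left_eq)
  have mod3: "(r + 12 * t + i) mod 3 = (r + i) mod 3" for i
  proof -
    have "r + 12 * t + i = (r + i) + 3 * (4 * t)" by simp
    then show ?thesis by (simp only: mod_mult_self2)
  qed
  have "r < 12" by (simp add: r_def)
  then have "r \<in> {0, 1, 2, 3, 4, 5, 6, 7, 8, 9, 10, 11}" by (rule less_12_cases)
  then have "of_int (\<rho> (r + 3) + \<rho> (r + 2) + \<rho> (r + 1) + \<rho> (r + 0))
      = (1 - (if (r + 3) mod 3 = 2 then 1 else 0)) + (1 - (if (r + 1) mod 3 = 2 then 1 else 0 :: rat))"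
    by (elim disjE insertE emptyE) (simp_all add: \<rho>_def)
  then show ?thesis
    using \<rho>_mod[of 0] by (simp only: k \<rho>_mod mod3 geometric_sums_def fps_nth_Abs_fps add_is_0 if_False simp_thms add_0_right) simp
qed

text \<open>The function \<open>\<rho>\<close> collects all contributions of the generating function that are rational in $q$, among
them the correction $2q^2$ that stems from the missing lower theta exponents.\<close>
lemma \<rho>_gf:
  "(1 + fps_X) * (1 + fps_X ^ 2) * Abs_fps (\<lambda>n. of_int (\<rho> n)) = (1 + fps_X ^ 2) * geometric_sums + 2 * fps_X ^ 2"
proof (rule fps_ext)
  fix n :: nat
  define R :: "rat fps" where "R = Abs_fps (\<lambda>n. of_int (\<rho> n))"
  have L: "(1 + fps_X) * (1 + fps_X ^ 2) * R = R + fps_X ^ 1 * R + fps_X ^ 2 * R + fps_X ^ 3 * R"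
    by (simp add: algebra_simps eval_nat_numeral)
  have Rt: "(1 + fps_X ^ 2) * geometric_sums + 2 * fps_X ^ 2 = geometric_sums + fps_X ^ 2 * geometric_sums + fps_const 2 * fps_X ^ 2"
    by (simp add: algebra_simps numeral_fps_const)
  consider "n = 0" | "n = 1" | "n = 2" | k where "n = k + 3"
    by (metis One_nat_def add.commute less_2_cases_iff less_Suc_eq le_Suc_ex not_less numeral_2_eq_2 numeral_3_eq_3)
  then have "(R + fps_X ^ 1 * R + fps_X ^ 2 * R + fps_X ^ 3 * R) $ n
     = (geometric_sums + fps_X ^ 2 * geometric_sums + fps_const 2 * fps_X ^ 2) $ n"
    unfolding fps_add_nth fps_X_power_mult_nth fps_mult_left_const_nth fps_X_power_nth
  proof cases
    case 4
    then show "R $ n + (if n < 1 then 0 else R $ (n - 1)) + (if n < 2 then 0 else R $ (n - 2)) +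
      (if n < 3 then 0 else R $ (n - 3)) = geometric_sums $ n + (if n < 2 then 0 else geometric_sums $ (n - 2))
      + 2 * (if n = 2 then 1 else 0)"
      using \<rho>_recurrence[of k] by (simp add: R_def ac_simps)
  qed (simp_all add: R_def geometric_sums_def \<rho>_def)
  then show "((1 + fps_X) * (1 + fps_X ^ 2) * Abs_fps (\<lambda>n. of_int (\<rho> n))) $ n
     = ((1 + fps_X ^ 2) * geometric_sums + 2 * fps_X ^ 2 :: rat fps) $ n"
    unfolding R_def[symmetric] L Rt .
qed

definition b2_minus_\<rho> :: "nat \<Rightarrow> int" where
  "b2_minus_\<rho> n = b2'' n - \<rho> n"

text \<open>After subtraction of \<open>\<rho>\<close>, only the partial theta series is left, and a factor $1+q$ cancels.\<close>
lemma b2_minus_\<rho>_gf: "(1 + fps_X ^ 2) * Abs_fps (\<lambda>n. of_int (b2_minus_\<rho> n)) = - (fps_X * partial_theta)"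
proof -
  define R :: "rat fps" where "R = Abs_fps (\<lambda>n. of_int (\<rho> n))"
  define X :: "rat fps" where "X = fps_X"
  have e: "Abs_fps (\<lambda>n. of_int (b2_minus_\<rho> n)) = b2_gf - R"
    by (rule fps_ext) (simp add: b2_minus_\<rho>_def b2_gf_def R_def)
  have "(1 + X) * ((1 + X ^ 2) * (b2_gf - R)) = (1 + X) * - (X * partial_theta)"
    using gf_identity \<rho>_gf unfolding R_def[symmetric] X_def[symmetric] by algebra
  moreover have "1 + X \<noteq> 0"
    using one_plus_X_power_nonzero[of 1] by (simp add: X_def)
  ultimately show ?thesis
    unfolding e X_def[symmetric] by (simp only: mult_cancel_left simp_thms)
qed

text \<open>Hence steps of length 2 just flip the sign, except where \<open>n + 1\<close> is a triangular number.\<close>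
lemma b2_minus_\<rho>_recurrence:
  "b2_minus_\<rho> 0 = 0" "b2_minus_\<rho> (Suc 0) = -1" "of_int (b2_minus_\<rho> (n + 2)) = - of_int (b2_minus_\<rho> n) - partial_theta $ (n + 1)"
proof -
  have *: "of_int (b2_minus_\<rho> n) + (if n < 2 then 0 else of_int (b2_minus_\<rho> (n - 2))) = - (if n = 0 then 0 else partial_theta $ (n - 1))" for n
    using arg_cong[OF b2_minus_\<rho>_gf, of "\<lambda>f. f $ n"]
    unfolding distrib_right fps_add_nth fps_X_power_mult_nth fps_nth_Abs_fps by simp
  have "partial_theta $ 0 = 1" using partial_theta_nth_T[of 0] by (simp add: T_0 theta_sign_def)
  then show "b2_minus_\<rho> 0 = 0" "b2_minus_\<rho> (Suc 0) = -1"
    using *[of 0] *[of "Suc 0"] by simp_all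
  show "of_int (b2_minus_\<rho> (n + 2)) = - of_int (b2_minus_\<rho> n) - partial_theta $ (n + 1)"
    using *[of "n + 2"] by simp
qed

lemma \<chi>_add_2: "\<chi> (n + 2) = - \<chi> n"
proof -
  have "n mod 4 < 4" by simp
  then have "n mod 4 \<in> {0, 1, 2, 3}" by auto
  moreover have "(n + 2) mod 4 = (n mod 4 + 2) mod 4" by presburger
  ultimately show ?thesis unfolding \<chi>_def by auto
qed

lemma \<mu>_add_2: "\<mu> u (n + 2) = \<mu> u n"
  by (simp add: \<mu>_def)

text \<open>The period 8 in the index of \<open>\<mu>\<close> has its origin here.\<close>
lemma T_add_8_times: "T (8 * m + v) mod 4 = T v mod 4"
proof (induction m)
  case (Suc m)
  have "T (8 * Suc m + v) = T (Suc (Suc (Suc (Suc (Suc (Suc (Suc (Suc (8 * m + v)))))))))"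
    by (rule arg_cong[of _ _ T]) simp
  also have "\<dots> = T (8 * m + v) + 4 * (2 * (8 * m + v) + 9)"
    unfolding T_Suc by simp
  finally show ?case using Suc by (simp only: mod_mult_self2)
qed simp

lemma \<mu>_mod: "\<mu> u n = \<mu> u (n mod 4)"
proof -
  have "even n = even (n mod 4)" by presburger
  then show ?thesis by (simp add: \<mu>_def minus_one_power_iff)
qed

lemma \<chi>_mod: "\<chi> n = \<chi> (n mod 4)"
  by (simp add: \<chi>_def)

text \<open>The interval before \<open>T \<tau>\<close> has index \<open>\<tau>\<close>, the one after it \<open>Suc \<tau>\<close>. On the parity class
of \<open>T \<tau> + 1\<close> the value of \<open>\<mu>\<close> jumps by the theta coefficient at \<open>T \<tau>\<close>, up to the sign of \<open>\<chi>\<close>; on the other class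
it does not change. The index is reduced modulo 8, with residue 0 in place of 8: both give the value
0 of \<open>\<mu>\<close>.\<close>
lemma \<mu>_jump:
  "(\<mu> (Suc \<tau> mod 8) (T \<tau> + 1) - \<mu> (\<tau> mod 8) (T \<tau> + 1)) * \<chi> (T \<tau>) = - ((-1) ^ (\<tau> div 2))"
  "\<mu> (Suc \<tau> mod 8) (T \<tau>) = \<mu> (\<tau> mod 8) (T \<tau>)"
proof -
  define m v where "m = \<tau> div 8" and "v = \<tau> mod 8"
  have \<tau>: "\<tau> = 8 * m + v" by (simp add: m_def v_def)
  have mods: "\<tau> mod 8 = v mod 8" "Suc \<tau> mod 8 = Suc v mod 8"
    unfolding \<tau> by (simp_all add: mod_Suc)
  have "\<tau> = v + 2 * (2 * (2 * m))" unfolding \<tau> by simp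
  then have "\<tau> div 2 = 2 * (2 * m) + v div 2" by simp
  then have sgn: "(-1 :: int) ^ (\<tau> div 2) = (-1) ^ (v div 2)"
    by (simp only: power_add power_mult) simp
  have T4: "T \<tau> mod 4 = T v mod 4" unfolding \<tau> by (rule T_add_8_times)
  then have T4': "(T \<tau> + 1) mod 4 = (T v + 1) mod 4" by (metis mod_add_left_eq)
  have "v < 8" by (simp add: v_def)
  then have "v \<in> {0, 1, 2, 3, 4, 5, 6, 7}" by auto
  then have "(\<mu> (Suc v mod 8) ((T v + 1) mod 4) - \<mu> (v mod 8) ((T v + 1) mod 4)) * \<chi> (T v mod 4)
      = - ((-1) ^ (v div 2)) \<and> \<mu> (Suc v mod 8) (T v mod 4) = \<mu> (v mod 8) (T v mod 4)"
    by (elim disjE insertE emptyE) (simp_all add: \<mu>_def \<chi>_def T_def choose_two)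
  then show "(\<mu> (Suc \<tau> mod 8) (T \<tau> + 1) - \<mu> (\<tau> mod 8) (T \<tau> + 1)) * \<chi> (T \<tau>) = - ((-1) ^ (\<tau> div 2))"
    and "\<mu> (Suc \<tau> mod 8) (T \<tau>) = \<mu> (\<tau> mod 8) (T \<tau>)"
    unfolding mods sgn \<mu>_mod[of _ "T \<tau> + 1"] \<mu>_mod[of _ "T \<tau>"] \<chi>_mod[of "T \<tau>"] T4 T4'
    by blast+
qed

lemma not_T_between: "T \<tau> < n \<Longrightarrow> n < T (Suc \<tau>) \<Longrightarrow> n \<notin> range T"
  by (auto simp: strict_mono_less[OF strict_mono_T])

text \<open>Both sides satisfy the same recurrence with steps of length 2. Inside an interval between triangular
numbers, \<open>\<mu>\<close> depends on the parity only and \<open>\<chi>\<close> changes sign; the steps that enter a new interval are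
those from \<open>T \<tau>\<close> and from \<open>T \<tau> - 1\<close>, for which \<open>\<mu>_jump\<close> gives the change of \<open>\<mu>\<close>.\<close>
lemma b2_minus_\<rho>_eq:
  assumes "T \<tau> < n" "n \<le> T (Suc \<tau>)"
  shows "b2_minus_\<rho> n = \<mu> (Suc \<tau> mod 8) n * \<chi> (n - 1)"
  using assms
proof (induction n arbitrary: \<tau> rule: less_induct)
  case (less n)
  have T_simps: "T 0 = 0" "T (Suc 0) = 1" "T 2 = 3"
    by (simp_all add: T_0 T_Suc numeral_2_eq_2)
  consider "n = 1" | "n = 2" | k where "n = k + 2" "k \<ge> 1"
    using less.prems(1) by (metis One_nat_def Suc_leI add_2_eq_Suc' gr0_conv_Suc not_gr_zero not_less_zero numeral_2_eq_2)
  then show ?case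
  proof cases
    case 1
    have "\<tau> = 0" using less.prems le_T[of \<tau>] 1 by simp
    then show ?thesis using 1 b2_minus_\<rho>_recurrence by (simp add: \<mu>_def \<chi>_def)
  next
    case 2
    have "\<tau> < 2" using less.prems le_T[of \<tau>] 2 by simp
    then have "\<tau> = 1" using less.prems 2 by (cases \<tau>) (auto simp: T_simps)
    moreover have "partial_theta $ 1 = 1" using partial_theta_nth_T[of 1] by (simp add: T_simps theta_sign_def)
    then have "of_int (b2_minus_\<rho> 2) = (of_int (-1) :: rat)"
      using b2_minus_\<rho>_recurrence(3)[of 0] unfolding b2_minus_\<rho>_recurrence(1) add_0 by simp
    then have "b2_minus_\<rho> 2 = -1" by (simp only: of_int_eq_iff)
    ultimately show ?thesis using 2 by (simp add: \<mu>_def \<chi>_def)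
  next
    case 3
    have \<chi>: "\<chi> (n - 1) = - \<chi> (k - 1)"
      using \<chi>_add_2[of "k - 1"] 3 by simp
    have \<mu>: "\<mu> u n = \<mu> u k" for u
      using \<mu>_add_2 3 by simp
    have T_pred: "T \<tau> = T (\<tau> - 1) + \<tau>" 
      using T_Suc[of "\<tau> - 1"] by (cases \<tau>) (simp_all add: T_0)
    consider "k > T \<tau>" | "k = T \<tau>" | "k + 1 = T \<tau>"
      using less.prems(1) 3 by linarith
    then show ?thesis
    proof cases
      case 1
      have "partial_theta $ (k + 1) = 0"
        using not_T_between[of \<tau> "k + 1"] 1 less.prems 3 by (intro partial_theta_nth_not_T) simp
      then have "b2_minus_\<rho> n = - b2_minus_\<rho> k" using b2_minus_\<rho>_recurrence(3)[of k] 3 by simp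
      also have "b2_minus_\<rho> k = \<mu> (Suc \<tau> mod 8) k * \<chi> (k - 1)"
        using less.IH[of k \<tau>] less.prems 3 1 by simp
      finally show ?thesis using \<chi> \<mu> by simp
    next
      case 2
      then have pos: "\<tau> \<ge> 1" using 3 T_0 by (cases \<tau>) auto
      have "partial_theta $ (k + 1) = 0"
        using not_T_between[of \<tau> "k + 1"] 2 less.prems 3 by (intro partial_theta_nth_not_T) simp
      then have "b2_minus_\<rho> n = - b2_minus_\<rho> k" using b2_minus_\<rho>_recurrence(3)[of k] 3 by simp
      also have "b2_minus_\<rho> k = \<mu> (\<tau> mod 8) k * \<chi> (k - 1)"
        using less.IH[of k "\<tau> - 1"] 3 2 pos T_pred by simp
      also have "\<mu> (\<tau> mod 8) k = \<mu> (Suc \<tau> mod 8) k"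
        using \<mu>_jump(2)[of \<tau>] 2 by simp
      finally show ?thesis using \<chi> \<mu> by simp
    next
      case pred: 3
      then have pos: "\<tau> \<ge> 2"
        using 3 T_simps by (cases \<tau>; cases "\<tau> - 1") auto
      have "partial_theta $ (k + 1) = theta_sign \<tau>" using pred partial_theta_nth_T by simp
      then have "of_int (b2_minus_\<rho> n) = (of_int (- b2_minus_\<rho> k - (-1) ^ (\<tau> div 2)) :: rat)"
        using b2_minus_\<rho>_recurrence(3)[of k] 3 by (simp add: theta_sign_def)
      then have "b2_minus_\<rho> n = - b2_minus_\<rho> k - (-1) ^ (\<tau> div 2)"
        by (simp only: of_int_eq_iff)
      also have "b2_minus_\<rho> k = \<mu> (\<tau> mod 8) k * \<chi> (k - 1)"
        using less.IH[of k "\<tau> - 1"] 3 pred pos T_pred by simp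
      finally have "b2_minus_\<rho> n = \<mu> (\<tau> mod 8) n * \<chi> (n - 1) - (-1) ^ (\<tau> div 2)"
        using \<chi> \<mu> by simp
      moreover have "n = T \<tau> + 1" "n - 1 = T \<tau>" using 3 pred by simp_all
      ultimately show ?thesis using \<mu>_jump(1)[of \<tau>] by (simp add: algebra_simps)
    qed
  qed
qed

theorem corollary4:
  shows "b2'' 0 = 0 \<and>
    (\<forall>n m u :: nat. 1 \<le> n \<longrightarrow> 1 \<le> u \<longrightarrow> u \<le> 8 \<longrightarrow>
       T (8 * m + u - 1) < n \<longrightarrow> n \<le> T (8 * m + u) \<longrightarrow>
       b2'' n = \<rho> n + \<mu> u n * \<chi> (n - 1))"
proof (intro conjI allI impI)
  show "b2'' 0 = 0" using b2_minus_\<rho>_recurrence(1) by (simp add: b2_minus_\<rho>_def \<rho>_def)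
next
  fix n m u :: nat
  assume u: "1 \<le> u" "u \<le> 8" and n: "T (8 * m + u - 1) < n" "n \<le> T (8 * m + u)"
  have Suc: "Suc (8 * m + u - 1) = 8 * m + u" using u by simp
  have "b2_minus_\<rho> n = \<mu> ((8 * m + u) mod 8) n * \<chi> (n - 1)"
    using b2_minus_\<rho>_eq[of "8 * m + u - 1" n] n unfolding Suc by blast
  moreover have "\<mu> ((8 * m + u) mod 8) n = \<mu> u n"
    using u by (cases "u = 8") (simp_all add: \<mu>_def)
  ultimately show "b2'' n = \<rho> n + \<mu> u n * \<chi> (n - 1)"
    by (simp add: b2_minus_\<rho>_def)
qed

end
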